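(* Let $L$ and $L'$ be lines in $\mathbb{P}^2$ defined by $a_0x_0+a_1x_1+a_2x_2=0$ and $a'_0x_0+a'_1x_1+a'_2x_2=0$ respectively, and set $A=[a_0:a_1:a_2]$, $A'=[a'_0:a'_1:a'_2]$. Let $X\subseteq L\setminus\Delta_1$ be a set of $n\geq 2$ points and $X'\subseteq L'\setminus\Delta_1$ a set of $m\geq 2$ points. Suppose $A,A'\notin\Delta_1$ and $X\cap X'=\emptyset$. Then $X\star X'$ is the $nm$ element grid $(X\star L')\cap(X'\star L)$ if and only if $P\star A\neq P'\star A'$ for all $P\in X$ and all $P'\in X'$.
   Context: Work over an algebraically closed field $\mathbb{K}$; $\mathbb{P}^2$ is the projective plane with coordinates $x_0,x_1,x_2$. For points $P=[p_0:p_1:p_2]$, $Q=[q_0:q_1:q_2]$, the Hadamard product is $P\star Q=[p_0q_0:p_1q_1:p_2q_2]$, defined when not all $p_iq_i$ vanish. For subsets $X,Y\subseteq\mathbb{P}^2$, $X\star Y$ is the Zariski closure of the set of all defined products $P\star Q$ with $P\in X$, $Q\in Y$; in particular, for finite $X,X'$, $X\star X'$ is the finite set of defined products, and for finite $X$ and a line $L'$, $X\star L'=\bigcup_{P\in X}P\star L'$. $\Delta_1$ is the set of points of $\mathbb{P}^2$ with at least one zero coordinate. "$X\star X'$ is the $nm$ element grid $(X\star L')\cap(X'\star L)$" means that $X\star X'=(X\star L')\cap(X'\star L)$ as subsets of $\mathbb{P}^2$ and that this set consists of exactly $nm$ points. *)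

theory Defs
  imports "HOL-Analysis.Analysis" "HOL-Library.Poly_Mapping"
    "HOL-Computational_Algebra.Polynomial"
begin

(* The index type 3 has the elements 0, 1, 2 (its 3 equals its 0), so that v $ 0, v $ 1, v $ 2
   are the homogeneous coordinates of a point. *)

definition proj_rel :: "'k::field ^ 3 \<Rightarrow> 'k ^ 3 \<Rightarrow> bool" where
  "proj_rel v w \<longleftrightarrow> v \<noteq> 0 \<and> w \<noteq> 0 \<and> (\<exists>c. c \<noteq> 0 \<and> w = c *s v)"

lemma part_equivp_proj_rel: "part_equivp (proj_rel :: 'k::field ^ 3 \<Rightarrow> 'k ^ 3 \<Rightarrow> bool)"
proof (rule part_equivpI)
  have "proj_rel (1 :: 'k ^ 3) 1"
    unfolding proj_rel_def by (auto intro!: exI[of _ 1] simp: vec_eq_iff)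
  then show "\<exists>x :: 'k ^ 3. proj_rel x x" by blast
  show "symp (proj_rel :: 'k ^ 3 \<Rightarrow> _)"
  proof (rule sympI)
    fix v w :: "'k ^ 3"
    assume "proj_rel v w"
    then obtain c where "v \<noteq> 0" "w \<noteq> 0" "c \<noteq> 0" "w = c *s v"
      unfolding proj_rel_def by blast
    then have "v = inverse c *s w" by (simp add: vec_eq_iff)
    with \<open>v \<noteq> 0\<close> \<open>w \<noteq> 0\<close> \<open>c \<noteq> 0\<close> show "proj_rel w v"
      unfolding proj_rel_def using nonzero_imp_inverse_nonzero by blast
  qed
  show "transp (proj_rel :: 'k ^ 3 \<Rightarrow> _)"
  proof (rule transpI)
    fix u v w :: "'k ^ 3"
    assume "proj_rel u v" "proj_rel v w"
    then obtain c d where "u \<noteq> 0" "w \<noteq> 0" "c \<noteq> 0" "d \<noteq> 0" "v = c *s u" "w = d *s v"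
      unfolding proj_rel_def by blast
    then have "d * c \<noteq> 0" "w = (d * c) *s u" by (simp_all add: vec_eq_iff)
    with \<open>u \<noteq> 0\<close> \<open>w \<noteq> 0\<close> show "proj_rel u w"
      unfolding proj_rel_def by blast
  qed
qed

(* For v \<noteq> 0, proj_point v is the point [v $ 0 : v $ 1 : v $ 2]; proj_point 0 is meaningless. *)
quotient_type (overloaded) 'k proj_plane = "'k::field ^ 3" / partial: proj_rel
  morphisms rep_proj_plane proj_point
  by (rule part_equivp_proj_rel)

lemma proj_point_eq_iff:
  "v \<noteq> 0 \<Longrightarrow> w \<noteq> 0 \<Longrightarrow> proj_point v = proj_point w \<longleftrightarrow> (\<exists>c. c \<noteq> 0 \<and> w = c *s v)"
proof -
  assume "v \<noteq> 0" "w \<noteq> 0"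
  have refl: "proj_rel u u" if "u \<noteq> 0" for u :: "'a ^ 3"
    using that unfolding proj_rel_def by (auto intro!: exI[of _ 1])
  show ?thesis
    using Quotient3_rel[OF Quotient3_proj_plane, of v w] refl \<open>v \<noteq> 0\<close> \<open>w \<noteq> 0\<close>
    by (auto simp: proj_rel_def)
qed

lemma proj_point_exhaust:
  obtains v where "v \<noteq> 0" "P = proj_point v"
  using Quotient3_abs_rep[OF Quotient3_proj_plane, of P]
    Quotient3_rep_reflp[OF Quotient3_proj_plane, of P]
  by (metis proj_rel_def)

lift_definition on_line :: "'k::field ^ 3 \<Rightarrow> 'k proj_plane \<Rightarrow> bool"
  is "\<lambda>a v. (\<Sum>i\<in>UNIV. a $ i * v $ i) = 0"
proof -
  fix a v w :: "'k ^ 3"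
  assume "proj_rel v w"
  then obtain c where "c \<noteq> 0" "w = c *s v" unfolding proj_rel_def by blast
  then have "(\<Sum>i\<in>UNIV. a $ i * w $ i) = c * (\<Sum>i\<in>UNIV. a $ i * v $ i)"
    by (simp add: sum_distrib_left mult.left_commute)
  with \<open>c \<noteq> 0\<close> show "((\<Sum>i\<in>UNIV. a $ i * v $ i) = 0) = ((\<Sum>i\<in>UNIV. a $ i * w $ i) = 0)"
    by simp
qed

(* A line only when a \<noteq> 0. *)
definition proj_line :: "'k::field ^ 3 \<Rightarrow> 'k proj_plane set" where
  "proj_line a = {P. on_line a P}"

lift_definition has_zero_coord :: "'k::field proj_plane \<Rightarrow> bool"
  is "\<lambda>v. \<exists>i. v $ i = 0"
  by (auto simp: proj_rel_def)

definition Delta1 :: "'k::field proj_plane set" where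
  "Delta1 = {P. has_zero_coord P}"

(* The product of vectors is componentwise; None means that the product of points is undefined. *)
lift_definition hadamard :: "'k::field proj_plane \<Rightarrow> 'k proj_plane \<Rightarrow> 'k proj_plane option"
  is "\<lambda>v w. if v * w = 0 then None else Some (v * w)"
proof -
  fix v v' w w' :: "'k ^ 3"
  assume "proj_rel v v'" "proj_rel w w'"
  then obtain c d where "c \<noteq> 0" "d \<noteq> 0" "v' = c *s v" "w' = d *s w"
    unfolding proj_rel_def by blast
  then have cd: "c * d \<noteq> 0" and vw': "v' * w' = (c * d) *s (v * w)"
    by (simp_all add: vec_eq_iff mult_ac)
  then have "v' * w' = 0 \<longleftrightarrow> v * w = 0" by simp
  with cd vw' show "rel_option proj_rel (if v * w = 0 then None else Some (v * w))
      (if v' * w' = 0 then None else Some (v' * w'))"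
    by (auto simp: proj_rel_def)
qed

lemma hadamard_proj_point:
  assumes "v \<noteq> 0" "w \<noteq> 0"
  shows "hadamard (proj_point v) (proj_point w) =
    (if v * w = 0 then None else Some (proj_point (v * w)))"
proof -
  have refl: "proj_rel u u" if "u \<noteq> 0" for u :: "'a ^ 3"
    using that unfolding proj_rel_def by (auto intro!: exI[of _ 1])
  show ?thesis
    using hadamard.abs_eq[OF refl[OF assms(1)] refl[OF assms(2)]] by simp
qed

(* Polynomials in x_0, x_1, x_2: finitely supported families of coefficients, indexed by the
   exponent vectors of monomials. *)
type_synonym 'k poly3 = "(3 \<Rightarrow>\<^sub>0 nat) \<Rightarrow>\<^sub>0 'k"

definition eval3 :: "'k::field poly3 \<Rightarrow> 'k ^ 3 \<Rightarrow> 'k" where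
  "eval3 f v = (\<Sum>m\<in>Poly_Mapping.keys f.
     Poly_Mapping.lookup f m * (\<Prod>i\<in>UNIV. v $ i ^ Poly_Mapping.lookup m i))"

definition homogeneous3 :: "'k::field poly3 \<Rightarrow> bool" where
  "homogeneous3 f \<longleftrightarrow>
     (\<exists>d. \<forall>m\<in>Poly_Mapping.keys f. (\<Sum>i\<in>UNIV. Poly_Mapping.lookup m i) = d)"

definition vanishes_at :: "'k::field poly3 \<Rightarrow> 'k proj_plane \<Rightarrow> bool" where
  "vanishes_at f P \<longleftrightarrow> (\<forall>v. v \<noteq> 0 \<and> proj_point v = P \<longrightarrow> eval3 f v = 0)"

definition zariski_closed :: "'k::field proj_plane set \<Rightarrow> bool" where
  "zariski_closed Z \<longleftrightarrow>
     (\<exists>F. (\<forall>f\<in>F. homogeneous3 f) \<and> Z = {P. \<forall>f\<in>F. vanishes_at f P})"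

definition hadamard_set ::
    "'k::field proj_plane set \<Rightarrow> 'k proj_plane set \<Rightarrow> 'k proj_plane set"  (infixl "\<star>" 70) where
  "X \<star> Y = zariski_closed hull {R. \<exists>P\<in>X. \<exists>Q\<in>Y. hadamard P Q = Some R}"

end

theory Submission
  imports Defs
begin

text \<open>
  For a point \<open>P\<close> off the coordinate triangle, \<open>Q \<mapsto> P \<star> Q\<close> is an invertible diagonal change of
  coordinates, so \<open>P \<star> L'\<close> is the line whose coefficients are those of \<open>L'\<close> divided by the
  coordinates of \<open>P\<close>. Hence \<open>P \<star> L'\<close> and \<open>P' \<star> L\<close> are the same line iff \<open>a'\<^sub>i / p\<^sub>i\<close> and
  \<open>a\<^sub>i / p'\<^sub>i\<close> are proportional, which after clearing denominators says \<open>P \<star> A = P' \<star> A'\<close>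
  (\<open>line_coeffs_eq_iff\<close>).

  If no two such lines coincide, each \<open>P \<star> L'\<close> meets each \<open>P' \<star> L\<close> in the single point
  \<open>P \<star> P'\<close> (\<open>line_translates_meet\<close>), so
  \<open>(X \<star> L') \<inter> (X' \<star> L) = X \<star> X'\<close>. The \<open>nm\<close> products are distinct by
  \<open>hadamard_inj_if_no_coincidence\<close>: if \<open>P \<star> P' = Q \<star> Q'\<close> and \<open>t = q / p\<close> is the coordinatewise
  quotient, then \<open>(a\<^sub>i p\<^sub>i)\<close> and \<open>(a'\<^sub>i q'\<^sub>i)\<close> are both orthogonal to \<open>(1, 1, 1)\<close> and to \<open>t\<close>. If
  \<open>P \<noteq> Q\<close>, then \<open>(1, 1, 1)\<close> and \<open>t\<close> are linearly independent, so the vectors orthogonal to both form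
  a line through the origin and \<open>P \<star> A = Q' \<star> A'\<close>.

  Conversely, if \<open>P \<star> A = P' \<star> A'\<close>, then the intersection contains the whole line
  \<open>P \<star> L' = P' \<star> L\<close>. It is infinite because an algebraically closed field is infinite, so the
  intersection is not a finite grid.

  The products are Zariski closures of the sets of pointwise products. For finite sets of points and
  finite unions of lines the closure changes nothing, since these sets are already closed.
\<close>

section \<open>Algebraic sets in the plane\<close>

lemma eval3_superset:
  assumes "finite K" "Poly_Mapping.keys f \<subseteq> K"
  shows "eval3 f v =
    (\<Sum>m\<in>K. Poly_Mapping.lookup f m * (\<Prod>i\<in>UNIV. v $ i ^ Poly_Mapping.lookup m i))"
  unfolding eval3_def
  by (rule sum.mono_neutral_left) (use assms in \<open>auto simp: in_keys_iff\<close>)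

lemma eval3_add: "eval3 (f + g) v = eval3 f v + eval3 g v"
proof -
  let ?K = "Poly_Mapping.keys f \<union> Poly_Mapping.keys g"
  have "Poly_Mapping.keys (f + g) \<subseteq> ?K" by (rule keys_add)
  then show ?thesis
    by (simp add: eval3_superset[of ?K] lookup_add distrib_right sum.distrib)
qed

lemma eval3_sum: "eval3 (\<Sum>x\<in>S. f x) v = (\<Sum>x\<in>S. eval3 (f x) v)"
  by (induction S rule: infinite_finite_induct) (simp_all add: eval3_add, simp_all add: eval3_def)

lemma eval3_single:
  "eval3 (Poly_Mapping.single m c) v = c * (\<Prod>i\<in>UNIV. v $ i ^ Poly_Mapping.lookup m i)"
  by (subst eval3_superset[of "{m}"]) auto

lemma poly_mapping_sum_single:
  "f = (\<Sum>m\<in>Poly_Mapping.keys f. Poly_Mapping.single m (Poly_Mapping.lookup f m))"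
  by (rule poly_mapping_eqI) (auto simp: lookup_sum lookup_single when_def in_keys_iff)

lemma eval3_mult: "eval3 (f * g) v = eval3 f v * eval3 g v"
proof -
  let ?M = "\<lambda>m. \<Prod>i\<in>UNIV. v $ i ^ Poly_Mapping.lookup m i"
  have "eval3 (f * g) v = eval3 ((\<Sum>m\<in>Poly_Mapping.keys f. Poly_Mapping.single m (Poly_Mapping.lookup f m)) *
      (\<Sum>l\<in>Poly_Mapping.keys g. Poly_Mapping.single l (Poly_Mapping.lookup g l))) v"
    by (simp flip: poly_mapping_sum_single)
  also have "\<dots> = (\<Sum>m\<in>Poly_Mapping.keys f. \<Sum>l\<in>Poly_Mapping.keys g.
      (Poly_Mapping.lookup f m * Poly_Mapping.lookup g l) * ?M (m + l))"
    by (simp add: sum_product eval3_sum mult_single eval3_single)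
  also have "\<dots> = eval3 f v * eval3 g v"
    by (simp add: eval3_def sum_product lookup_add power_add prod.distrib mult_ac)
  finally show ?thesis .
qed

lemma homogeneous3_mult:
  assumes "homogeneous3 f" "homogeneous3 g"
  shows "homogeneous3 (f * g)"
proof -
  obtain d e where
    d: "\<And>m. m \<in> Poly_Mapping.keys f \<Longrightarrow> (\<Sum>i\<in>UNIV. Poly_Mapping.lookup m i) = d" and
    e: "\<And>m. m \<in> Poly_Mapping.keys g \<Longrightarrow> (\<Sum>i\<in>UNIV. Poly_Mapping.lookup m i) = e"
    using assms unfolding homogeneous3_def by blast
  have "(\<Sum>i\<in>UNIV. Poly_Mapping.lookup m i) = d + e" if "m \<in> Poly_Mapping.keys (f * g)" for m
    using keys_mult[of f g] that d e by (fastforce simp: lookup_add sum.distrib)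
  then show ?thesis unfolding homogeneous3_def by blast
qed

lemma eval3_scale_homogeneous:
  assumes "homogeneous3 f"
  obtains d where "\<And>c v. eval3 f (c *s v) = c ^ d * eval3 f v"
proof -
  obtain d where d: "\<And>m. m \<in> Poly_Mapping.keys f \<Longrightarrow> (\<Sum>i\<in>UNIV. Poly_Mapping.lookup m i) = d"
    using assms unfolding homogeneous3_def by blast
  have "eval3 f (c *s v) = c ^ d * eval3 f v" for c v
    unfolding eval3_def sum_distrib_left
    by (rule sum.cong) (auto simp: power_mult_distrib prod.distrib simp flip: power_sum d)
  then show thesis by (rule that)
qed

lemma vanishes_at_proj_point:
  assumes "homogeneous3 f" "v \<noteq> 0"
  shows "vanishes_at f (proj_point v) \<longleftrightarrow> eval3 f v = 0"
proof -
  obtain d where "\<And>c u. eval3 f (c *s u) = c ^ d * eval3 f u"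
    using eval3_scale_homogeneous[OF assms(1)] by blast
  then show ?thesis
    unfolding vanishes_at_def using assms(2) by (metis mult_zero_right proj_point_eq_iff)
qed

lemma zariski_closed_empty: "zariski_closed ({} :: 'k::field proj_plane set)"
proof -
  have "homogeneous3 1" by (simp add: homogeneous3_def)
  moreover have "\<not> vanishes_at 1 P" for P :: "'k proj_plane"
  proof -
    obtain v where v: "v \<noteq> 0" "P = proj_point v" by (rule proj_point_exhaust)
    have "eval3 1 v = 1" by (simp add: eval3_def)
    with v show ?thesis unfolding vanishes_at_def by auto
  qed
  ultimately show ?thesis
    unfolding zariski_closed_def by (intro exI[of _ "{1}"]) auto
qed

text \<open>The products of an equation of the first set with an equation of the second set cut out
  the union.\<close>

lemma zariski_closed_Un:
  assumes "zariski_closed Y" "zariski_closed Z"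
  shows "zariski_closed (Y \<union> Z)"
proof -
  obtain F G where F: "\<forall>f\<in>F. homogeneous3 f" "Y = {P. \<forall>f\<in>F. vanishes_at f P}"
    and G: "\<forall>g\<in>G. homogeneous3 g" "Z = {P. \<forall>g\<in>G. vanishes_at g P}"
    using assms unfolding zariski_closed_def by blast
  let ?H = "{f * g |f g. f \<in> F \<and> g \<in> G}"
  have hom: "\<forall>h\<in>?H. homogeneous3 h" using F(1) G(1) homogeneous3_mult by blast
  have mult: "vanishes_at (f * g) P \<longleftrightarrow> vanishes_at f P \<or> vanishes_at g P"
    if fg: "f \<in> F" "g \<in> G" for f g P
  proof -
    obtain v where "v \<noteq> 0" "P = proj_point v" by (rule proj_point_exhaust)
    with fg F(1) G(1) show ?thesis
      by (simp add: vanishes_at_proj_point homogeneous3_mult eval3_mult)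
  qed
  have "Y \<union> Z = {P. \<forall>h\<in>?H. vanishes_at h P}"
    unfolding F(2) G(2) using mult by blast
  with hom show ?thesis unfolding zariski_closed_def by blast
qed

lemma zariski_closed_UN:
  assumes "finite I" "\<And>i. i \<in> I \<Longrightarrow> zariski_closed (Z i)"
  shows "zariski_closed (\<Union>i\<in>I. Z i)"
  using assms by (induction I) (simp_all add: zariski_closed_empty zariski_closed_Un)

lemma zariski_closed_INT:
  assumes "\<And>i. i \<in> I \<Longrightarrow> zariski_closed (Z i)"
  shows "zariski_closed (\<Inter>i\<in>I. Z i)"
proof -
  have "\<forall>i\<in>I. \<exists>F. (\<forall>f\<in>F. homogeneous3 f) \<and> Z i = {P. \<forall>f\<in>F. vanishes_at f P}"
    using assms unfolding zariski_closed_def by blast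
  from bchoice[OF this] obtain F where
    F: "\<forall>i\<in>I. (\<forall>f\<in>F i. homogeneous3 f) \<and> Z i = {P. \<forall>f\<in>F i. vanishes_at f P}"
    by blast
  then have "(\<Inter>i\<in>I. Z i) = {P. \<forall>f\<in>(\<Union>i\<in>I. F i). vanishes_at f P}" by auto
  with F show ?thesis
    unfolding zariski_closed_def by (intro exI[of _ "\<Union>i\<in>I. F i"]) auto
qed

section \<open>Points and lines in homogeneous coordinates\<close>

lemma on_line_proj_point:
  assumes "v \<noteq> 0"
  shows "on_line a (proj_point v) \<longleftrightarrow> (\<Sum>i\<in>UNIV. a $ i * v $ i) = 0"
proof -
  have "proj_rel v v" using assms unfolding proj_rel_def by (auto intro!: exI[of _ 1])
  then show ?thesis by (rule on_line.abs_eq)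
qed

lemma proj_point_in_Delta1:
  assumes "v \<noteq> 0"
  shows "proj_point v \<in> Delta1 \<longleftrightarrow> (\<exists>i. v $ i = 0)"
proof -
  have "proj_rel v v" using assms unfolding proj_rel_def by (auto intro!: exI[of _ 1])
  then show ?thesis unfolding Delta1_def by (simp add: has_zero_coord.abs_eq)
qed

lemma obtain_nonzero_coords:
  assumes "P \<notin> Delta1"
  obtains p where "P = proj_point p" "p \<noteq> 0" "\<And>i. p $ i \<noteq> 0"
  using assms proj_point_exhaust[of P] proj_point_in_Delta1 by metis

lemma proj_point_eq_iff_minors:
  assumes "v \<noteq> 0" "w \<noteq> 0"
  shows "proj_point v = proj_point w \<longleftrightarrow> (\<forall>i j. v $ i * w $ j = v $ j * w $ i)"
proof
  assume "proj_point v = proj_point w"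
  then show "\<forall>i j. v $ i * w $ j = v $ j * w $ i"
    using assms by (auto simp: proj_point_eq_iff)
next
  assume minors: "\<forall>i j. v $ i * w $ j = v $ j * w $ i"
  obtain k where k: "v $ k \<noteq> 0" using assms(1) by (auto simp: vec_eq_iff)
  have w: "w = (w $ k / v $ k) *s v"
    using minors[rule_format, of k] k by (simp add: vec_eq_iff field_simps)
  with assms(2) have "w $ k / v $ k \<noteq> 0" by (metis vector_smult_lzero)
  with w show "proj_point v = proj_point w" using assms by (metis proj_point_eq_iff)
qed

text \<open>Two distinct points lie on only one line. Let \<open>x\<close> be the cross product of \<open>v\<close> and \<open>w\<close>.
  A vector orthogonal to both \<open>v\<close> and \<open>w\<close> has zero cross product with \<open>x\<close>, so if \<open>x \<noteq> 0\<close>, both \<open>b\<close>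
  and \<open>c\<close> are proportional to \<open>x\<close>; if \<open>x = 0\<close>, then \<open>v\<close> and \<open>w\<close> are proportional.\<close>

lemma points_or_lines_coincide:
  fixes v w b c :: "'k::field ^ 3"
  assumes nz: "v \<noteq> 0" "w \<noteq> 0" "b \<noteq> 0" "c \<noteq> 0"
    and bv: "(\<Sum>i\<in>UNIV. b $ i * v $ i) = 0" and bw: "(\<Sum>i\<in>UNIV. b $ i * w $ i) = 0"
    and cv: "(\<Sum>i\<in>UNIV. c $ i * v $ i) = 0" and cw: "(\<Sum>i\<in>UNIV. c $ i * w $ i) = 0"
  shows "proj_point v = proj_point w \<or> proj_point b = proj_point c"
proof (rule disjCI)
  assume ne: "proj_point b \<noteq> proj_point c"
  define x :: "'k ^ 3" where "x = vector [v $ 2 * w $ 3 - v $ 3 * w $ 2,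
    v $ 3 * w $ 1 - v $ 1 * w $ 3, v $ 1 * w $ 2 - v $ 2 * w $ 1]"
  have x: "x $ 1 = v $ 2 * w $ 3 - v $ 3 * w $ 2" "x $ 2 = v $ 3 * w $ 1 - v $ 1 * w $ 3"
    "x $ 3 = v $ 1 * w $ 2 - v $ 2 * w $ 1"
    by (simp_all add: x_def)
  have cross: "u $ i * x $ j = u $ j * x $ i"
    if "(\<Sum>i\<in>UNIV. u $ i * v $ i) = 0" "(\<Sum>i\<in>UNIV. u $ i * w $ i) = 0" for u :: "'k ^ 3" and i j
  proof -
    have u: "u $ 1 * v $ 1 + u $ 2 * v $ 2 + u $ 3 * v $ 3 = 0"
      "u $ 1 * w $ 1 + u $ 2 * w $ 2 + u $ 3 * w $ 3 = 0"
      using that by (simp_all add: sum_3)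
    have "u $ 1 * x $ 2 = u $ 2 * x $ 1" "u $ 1 * x $ 3 = u $ 3 * x $ 1"
      "u $ 2 * x $ 3 = u $ 3 * x $ 2"
      unfolding x using u by algebra+
    then show ?thesis using exhaust_3[of i] exhaust_3[of j] by auto
  qed
  have "x = 0"
  proof (rule ccontr)
    assume "x \<noteq> 0"
    then have "proj_point b = proj_point x" "proj_point c = proj_point x"
      using cross[OF bv bw] cross[OF cv cw] nz by (simp_all add: proj_point_eq_iff_minors)
    with ne show False by simp
  qed
  then have "x $ 1 = 0" "x $ 2 = 0" "x $ 3 = 0" by simp_all
  then have "v $ i * w $ j = v $ j * w $ i" for i j
    using exhaust_3[of i] exhaust_3[of j] unfolding x by auto
  then show "proj_point v = proj_point w" using nz by (simp add: proj_point_eq_iff_minors)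
qed

lemma zariski_closed_line: "zariski_closed (proj_line a)"
proof -
  let ?m = "\<lambda>i::3. Poly_Mapping.single i (Suc 0)"
  define f where "f = (\<Sum>i\<in>UNIV. Poly_Mapping.single (?m i) (a $ i))"
  have "Poly_Mapping.keys f \<subseteq> range ?m"
    unfolding f_def using keys_sum[of "\<lambda>i. Poly_Mapping.single (?m i) (a $ i)" UNIV]
    by (auto split: if_splits)
  moreover have "(\<Sum>j\<in>UNIV. Poly_Mapping.lookup (?m i) j) = 1" for i
    by (simp add: lookup_single when_def)
  ultimately have hom: "homogeneous3 f"
    unfolding homogeneous3_def by blast
  have mon: "(\<Prod>j\<in>UNIV. v $ j ^ Poly_Mapping.lookup (?m i) j) = v $ i" for i and v :: "'a ^ 3"
    by (subst prod.remove[of _ i]) (auto simp: lookup_single when_def intro!: prod.neutral)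
  have "eval3 f v = (\<Sum>i\<in>UNIV. a $ i * v $ i)" for v
    unfolding f_def by (simp add: eval3_sum eval3_single mon)
  then have "vanishes_at f P \<longleftrightarrow> on_line a P" for P
    by (cases P rule: proj_point_exhaust) (simp add: vanishes_at_proj_point hom on_line_proj_point)
  then show ?thesis
    unfolding zariski_closed_def proj_line_def using hom by (intro exI[of _ "{f}"]) auto
qed

lemma zariski_closed_singleton: "zariski_closed {P}"
proof -
  obtain v where v: "v \<noteq> 0" "P = proj_point v" by (rule proj_point_exhaust)
  (* The lines v_i x_j = v_j x_i; for i = j the coefficient vector is 0 and imposes no condition. *)
  let ?b = "\<lambda>i j. v $ i *s axis j 1 - v $ j *s axis i 1"
  have axis: "(\<Sum>k\<in>UNIV. axis j 1 $ k * w $ k) = w $ j" for j and w :: "'a ^ 3"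
  proof -
    have "(\<Sum>k\<in>UNIV. axis j 1 $ k * w $ k) = (\<Sum>k\<in>UNIV. if k = j then w $ k else 0)"
      by (rule sum.cong) (auto simp: axis_def)
    then show ?thesis by simp
  qed
  have sum: "(\<Sum>k\<in>UNIV. ?b i j $ k * w $ k) = v $ i * w $ j - v $ j * w $ i" for i j w
    by (simp add: left_diff_distrib sum_subtractf mult.assoc axis flip: sum_distrib_left)
  have "Q = P \<longleftrightarrow> (\<forall>i j. on_line (?b i j) Q)" for Q
  proof -
    obtain w where w: "w \<noteq> 0" "Q = proj_point w" by (rule proj_point_exhaust)
    have "Q = P \<longleftrightarrow> (\<forall>i j. v $ i * w $ j = v $ j * w $ i)"
      using proj_point_eq_iff_minors[OF v(1) w(1)] v(2) w(2) by auto
    then show ?thesis unfolding w(2) on_line_proj_point[OF w(1)] sum by simp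
  qed
  then have "{P} = (\<Inter>ij\<in>UNIV. proj_line (?b (fst ij) (snd ij)))"
    by (auto simp: proj_line_def)
  then show ?thesis by (simp only: zariski_closed_INT zariski_closed_line)
qed

lemma zariski_closed_finite: "finite S \<Longrightarrow> zariski_closed S"
  using zariski_closed_UN[of S "\<lambda>P. {P}"] by (simp add: zariski_closed_singleton)

text \<open>A polynomial taking the value 1 at every element of a finite field has no root.\<close>

lemma infinite_alg_closed_field: "infinite (UNIV :: 'k::alg_closed_field set)"
proof
  assume fin: "finite (UNIV :: 'k set)"
  define q :: "'k poly" where "q = (\<Prod>x\<in>UNIV. [:-x, 1:])"
  have "degree q = card (UNIV :: 'k set)"
    unfolding q_def by (subst degree_prod_sum_eq) auto
  then have "degree q > 0" using fin by (simp add: card_gt_0_iff)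
  then have "degree (q + 1) > 0" by (simp add: degree_add_eq_left)
  then obtain x where "poly (q + 1) x = 0" using alg_closed_imp_poly_has_root by blast
  moreover have "poly q x = 0" using fin by (auto simp: q_def poly_prod)
  ultimately show False by simp
qed

lemma infinite_proj_line:
  fixes b :: "'k::alg_closed_field ^ 3"
  assumes "b $ 3 \<noteq> 0"
  shows "infinite (proj_line b)"
proof
  define v :: "'k \<Rightarrow> 'k ^ 3" where "v t = vector [1, t, - (b $ 1 + b $ 2 * t) / b $ 3]" for t
  assume fin: "finite (proj_line b)"
  have coords: "v t $ 1 = 1" "v t $ 2 = t" "v t $ 3 = - (b $ 1 + b $ 2 * t) / b $ 3" for t
    by (simp_all add: v_def)
  then have nz: "v t \<noteq> 0" for t by (metis zero_index zero_neq_one)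
  have "proj_point (v t) \<in> proj_line b" for t
    using assms by (simp add: proj_line_def on_line_proj_point nz sum_3 coords)
  then have "finite (range (\<lambda>t. proj_point (v t)))"
    using fin by (meson finite_subset image_subsetI)
  moreover have "inj (\<lambda>t. proj_point (v t))"
  proof (rule injI)
    fix s t assume "proj_point (v s) = proj_point (v t)"
    then have "v s $ 1 * v t $ 2 = v s $ 2 * v t $ 1"
      by (simp add: proj_point_eq_iff_minors nz)
    then show "s = t" by (simp add: coords)
  qed
  ultimately show False using infinite_alg_closed_field finite_imageD by blast
qed

section \<open>Hadamard translates of lines\<close>

lemma hadamard_nonzero_coords:
  fixes p q :: "'k::field ^ 3"
  assumes "\<And>i. p $ i \<noteq> 0" "q \<noteq> 0"
  shows "p * q \<noteq> 0" "hadamard (proj_point p) (proj_point q) = Some (proj_point (p * q))"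
proof -
  show nz: "p * q \<noteq> 0" using assms by (simp add: vec_eq_iff)
  have "p \<noteq> 0" using assms(1) by (metis zero_index)
  with nz assms(2) show "hadamard (proj_point p) (proj_point q) = Some (proj_point (p * q))"
    by (simp add: hadamard_proj_point)
qed

lemma hadamard_commute: "hadamard P Q = hadamard Q P"
  by (cases P rule: proj_point_exhaust, cases Q rule: proj_point_exhaust)
    (simp add: hadamard_proj_point mult.commute)

definition line_translate :: "'k::field proj_plane \<Rightarrow> 'k ^ 3 \<Rightarrow> 'k proj_plane set" where
  "line_translate P b = {R. \<exists>Q\<in>proj_line b. hadamard P Q = Some R}"

lemma line_translate_eq_proj_line:
  assumes "\<And>i. p $ i \<noteq> 0"
  shows "line_translate (proj_point p) b = proj_line (\<chi> i. b $ i / p $ i)"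
proof (intro set_eqI iffI)
  fix R assume "R \<in> line_translate (proj_point p) b"
  then obtain Q where Q: "on_line b Q" "hadamard (proj_point p) Q = Some R"
    unfolding line_translate_def proj_line_def by blast
  obtain q where q: "q \<noteq> 0" "Q = proj_point q" by (rule proj_point_exhaust)
  have "R = proj_point (p * q)" "p * q \<noteq> 0"
    using hadamard_nonzero_coords[OF assms q(1)] Q(2) q(2) by auto
  with Q(1) q assms show "R \<in> proj_line (\<chi> i. b $ i / p $ i)"
    by (simp add: proj_line_def on_line_proj_point)
next
  fix R assume R: "R \<in> proj_line (\<chi> i. b $ i / p $ i)"
  obtain r where r: "r \<noteq> 0" "R = proj_point r" by (rule proj_point_exhaust)
  define q where "q = (\<chi> i. r $ i / p $ i)"
  have pq: "p * q = r" using assms by (simp add: q_def vec_eq_iff)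
  then have q: "q \<noteq> 0" using r(1) by auto
  have "on_line b (proj_point q)"
    using R r q by (simp add: proj_line_def on_line_proj_point) (simp add: q_def)
  moreover have "hadamard (proj_point p) (proj_point q) = Some R"
    using hadamard_nonzero_coords[OF assms q] pq r(2) by simp
  ultimately show "R \<in> line_translate (proj_point p) b"
    unfolding line_translate_def proj_line_def by blast
qed

lemma zariski_closed_line_translate:
  assumes "P \<notin> Delta1"
  shows "zariski_closed (line_translate P b)"
  using assms zariski_closed_line line_translate_eq_proj_line obtain_nonzero_coords by metis

lemma infinite_line_translate:
  fixes b :: "'k::alg_closed_field ^ 3"
  assumes "P \<notin> Delta1" "\<And>i. b $ i \<noteq> 0"
  shows "infinite (line_translate P b)"
proof -
  obtain p where p: "P = proj_point p" "\<And>i. p $ i \<noteq> 0"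
    using obtain_nonzero_coords[OF assms(1)] by metis
  then show ?thesis
    using assms(2) by (simp add: line_translate_eq_proj_line infinite_proj_line)
qed

lemma hadamard_set_line:
  assumes "finite X" "X \<inter> Delta1 = {}"
  shows "X \<star> proj_line b = (\<Union>P\<in>X. line_translate P b)"
proof -
  have "zariski_closed (\<Union>P\<in>X. line_translate P b)"
    using assms by (intro zariski_closed_UN zariski_closed_line_translate) auto
  moreover have "{R. \<exists>P\<in>X. \<exists>Q\<in>proj_line b. hadamard P Q = Some R} = (\<Union>P\<in>X. line_translate P b)"
    by (auto simp: line_translate_def)
  ultimately show ?thesis unfolding hadamard_set_def by (simp add: hull_same)
qed

lemma hadamard_set_finite:
  assumes "finite X" "finite X'"
  shows "X \<star> X' = {R. \<exists>P\<in>X. \<exists>P'\<in>X'. hadamard P P' = Some R}"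
    and "finite (X \<star> X')"
proof -
  let ?S = "{R. \<exists>P\<in>X. \<exists>P'\<in>X'. hadamard P P' = Some R}"
  have "?S = (\<Union>P\<in>X. \<Union>P'\<in>X'. set_option (hadamard P P'))" by auto
  then have fin: "finite ?S" using assms by simp
  then show eq: "X \<star> X' = ?S"
    unfolding hadamard_set_def by (simp add: hull_same zariski_closed_finite)
  show "finite (X \<star> X')" using fin unfolding eq .
qed

section \<open>Coincidence of translated lines\<close>

text \<open>Clearing the denominators \<open>p\<^sub>i p\<^sub>j p'\<^sub>i p'\<^sub>j\<close> in the minors of the coefficient vectors
  \<open>(a'\<^sub>i / p\<^sub>i)\<close> and \<open>(a\<^sub>i / p'\<^sub>i)\<close> gives the minors of \<open>(a\<^sub>i p\<^sub>i)\<close> and \<open>(a'\<^sub>i p'\<^sub>i)\<close>.\<close>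

lemma line_coeffs_eq_iff:
  fixes a a' p p' :: "'k::field ^ 3"
  assumes nz: "\<And>i. a $ i \<noteq> 0" "\<And>i. a' $ i \<noteq> 0" "\<And>i. p $ i \<noteq> 0" "\<And>i. p' $ i \<noteq> 0"
  shows "proj_point (\<chi> i. a' $ i / p $ i) = proj_point (\<chi> i. a $ i / p' $ i) \<longleftrightarrow>
    hadamard (proj_point p) (proj_point a) = hadamard (proj_point p') (proj_point a')"
proof -
  have "a \<noteq> 0" "a' \<noteq> 0" "(\<chi> i. a' $ i / p $ i) \<noteq> 0" "(\<chi> i. a $ i / p' $ i) \<noteq> 0"
    using nz by (auto simp: vec_eq_iff)
  moreover have "a' $ i / p $ i * (a $ j / p' $ j) = a' $ j / p $ j * (a $ i / p' $ i) \<longleftrightarrow>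
      p $ i * a $ i * (p' $ j * a' $ j) = p $ j * a $ j * (p' $ i * a' $ i)" for i j
    using nz by (auto simp: field_simps)
  ultimately show ?thesis
    using nz hadamard_nonzero_coords[of p a] hadamard_nonzero_coords[of p' a']
    by (simp add: proj_point_eq_iff_minors)
qed

lemma proj_line_cong:
  assumes "b \<noteq> 0" "c \<noteq> 0" "proj_point b = proj_point c"
  shows "proj_line b = proj_line c"
proof -
  obtain k where k: "k \<noteq> 0" "c = k *s b" using assms proj_point_eq_iff by blast
  have "on_line c P \<longleftrightarrow> on_line b P" for P
  proof -
    obtain v where "v \<noteq> 0" "P = proj_point v" by (rule proj_point_exhaust)
    then show ?thesis
      using k by (simp add: on_line_proj_point mult.assoc flip: sum_distrib_left)
  qed
  then show ?thesis by (simp add: proj_line_def)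
qed

lemma line_translate_eq:
  fixes a a' :: "'k::field ^ 3"
  assumes nz: "\<And>i. a $ i \<noteq> 0" "\<And>i. a' $ i \<noteq> 0" and P: "P \<notin> Delta1" and P': "P' \<notin> Delta1"
    and eq: "hadamard P (proj_point a) = hadamard P' (proj_point a')"
  shows "line_translate P a' = line_translate P' a"
proof -
  obtain p where p: "P = proj_point p" "\<And>i. p $ i \<noteq> 0"
    using obtain_nonzero_coords[OF P] by metis
  obtain p' where p': "P' = proj_point p'" "\<And>i. p' $ i \<noteq> 0"
    using obtain_nonzero_coords[OF P'] by metis
  have "proj_point (\<chi> i. a' $ i / p $ i) = proj_point (\<chi> i. a $ i / p' $ i)"
    using eq line_coeffs_eq_iff[OF nz p(2) p'(2)] p(1) p'(1) by simp
  moreover have "(\<chi> i. a' $ i / p $ i) \<noteq> 0" "(\<chi> i. a $ i / p' $ i) \<noteq> 0"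
    using nz p(2) p'(2) by (auto simp: vec_eq_iff)
  ultimately show ?thesis
    using p p' proj_line_cong by (simp add: line_translate_eq_proj_line)
qed

text \<open>Distinct lines \<open>P \<star> L'\<close> and \<open>P' \<star> L\<close> have a single common point, and \<open>P \<star> P'\<close> is on both.\<close>

lemma line_translates_meet:
  fixes a a' :: "'k::field ^ 3"
  assumes nz: "\<And>i. a $ i \<noteq> 0" "\<And>i. a' $ i \<noteq> 0" and P: "P \<in> proj_line a - Delta1"
    and P': "P' \<in> proj_line a' - Delta1"
    and ne: "hadamard P (proj_point a) \<noteq> hadamard P' (proj_point a')"
    and R: "R \<in> line_translate P a'" "R \<in> line_translate P' a"
  shows "hadamard P P' = Some R"
proof -
  obtain p where p: "P = proj_point p" "p \<noteq> 0" "\<And>i. p $ i \<noteq> 0"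
    using obtain_nonzero_coords P by (metis DiffD2)
  obtain p' where p': "P' = proj_point p'" "p' \<noteq> 0" "\<And>i. p' $ i \<noteq> 0"
    using obtain_nonzero_coords P' by (metis DiffD2)
  obtain r where r: "r \<noteq> 0" "R = proj_point r" by (rule proj_point_exhaust)
  let ?b = "\<chi> i. a' $ i / p $ i" and ?c = "\<chi> i. a $ i / p' $ i"
  note pp' = hadamard_nonzero_coords[OF p(3) p'(2)]
  have "?b \<noteq> 0" "?c \<noteq> 0" using nz p(3) p'(3) by (auto simp: vec_eq_iff)
  moreover have "(\<Sum>i\<in>UNIV. ?b $ i * r $ i) = 0" "(\<Sum>i\<in>UNIV. ?c $ i * r $ i) = 0"
    using R r p p' by (simp_all add: line_translate_eq_proj_line proj_line_def on_line_proj_point)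
  moreover have "(\<Sum>i\<in>UNIV. ?b $ i * (p * p') $ i) = 0" "(\<Sum>i\<in>UNIV. ?c $ i * (p * p') $ i) = 0"
    using P P' p p' by (simp_all add: proj_line_def on_line_proj_point)
  moreover have "proj_point ?b \<noteq> proj_point ?c"
    using ne line_coeffs_eq_iff[OF nz p(3) p'(3)] p(1) p'(1) by simp
  ultimately have "proj_point (p * p') = R"
    using points_or_lines_coincide[OF pp'(1) r(1)] r(2) by blast
  with pp'(2) p(1) p'(1) show ?thesis by simp
qed

lemma hadamard_cancel_left:
  assumes P: "P \<notin> Delta1" and eq: "hadamard P Q = hadamard P Q'"
  shows "Q = Q'"
proof -
  obtain p where p: "P = proj_point p" "\<And>i. p $ i \<noteq> 0"
    using obtain_nonzero_coords[OF P] by metis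
  obtain q where q: "q \<noteq> 0" "Q = proj_point q" by (rule proj_point_exhaust)
  obtain q' where q': "q' \<noteq> 0" "Q' = proj_point q'" by (rule proj_point_exhaust)
  have "proj_point (p * q) = proj_point (p * q')"
    using eq p q q' hadamard_nonzero_coords[OF p(2)] by simp
  then obtain k where "k \<noteq> 0" "p * q' = k *s (p * q)"
    using proj_point_eq_iff hadamard_nonzero_coords(1)[OF p(2)] q(1) q'(1) by blast
  then have "q' = k *s q" using p(2) by (simp add: vec_eq_iff mult.left_commute)
  with \<open>k \<noteq> 0\<close> q q' show ?thesis using proj_point_eq_iff by blast
qed

text \<open>With \<open>t = q / p\<close>, so that \<open>t\<close> is also proportional to \<open>p' / q'\<close>, both \<open>(a\<^sub>i p\<^sub>i)\<close> and
  \<open>(a'\<^sub>i q'\<^sub>i)\<close> are orthogonal to \<open>(1, 1, 1)\<close> and to \<open>t\<close>: the four equations say that \<open>P\<close> and \<open>Q\<close>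
  are on \<open>L\<close> and that \<open>Q'\<close> and \<open>P'\<close> are on \<open>L'\<close>.\<close>

lemma hadamard_inj_if_no_coincidence:
  fixes a a' :: "'k::field ^ 3"
  assumes nz: "\<And>i. a $ i \<noteq> 0" "\<And>i. a' $ i \<noteq> 0"
    and P: "P \<in> proj_line a - Delta1" and Q: "Q \<in> proj_line a - Delta1"
    and P': "P' \<in> proj_line a' - Delta1" and Q': "Q' \<in> proj_line a' - Delta1"
    and ne: "hadamard P (proj_point a) \<noteq> hadamard Q' (proj_point a')"
    and eq: "hadamard P P' = hadamard Q Q'"
  shows "P = Q \<and> P' = Q'"
proof -
  obtain p where p: "P = proj_point p" "p \<noteq> 0" "\<And>i. p $ i \<noteq> 0"
    using obtain_nonzero_coords P by (metis DiffD2)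
  obtain q where q: "Q = proj_point q" "q \<noteq> 0" "\<And>i. q $ i \<noteq> 0"
    using obtain_nonzero_coords Q by (metis DiffD2)
  obtain p' where p': "P' = proj_point p'" "p' \<noteq> 0" "\<And>i. p' $ i \<noteq> 0"
    using obtain_nonzero_coords P' by (metis DiffD2)
  obtain q' where q': "Q' = proj_point q'" "q' \<noteq> 0" "\<And>i. q' $ i \<noteq> 0"
    using obtain_nonzero_coords Q' by (metis DiffD2)
  have anz: "a \<noteq> 0" "a' \<noteq> 0" using nz by (metis zero_index)+
  note pp' = hadamard_nonzero_coords[OF p(3) p'(2)] and qq' = hadamard_nonzero_coords[OF q(3) q'(2)]
    and pa = hadamard_nonzero_coords[OF p(3) anz(1)] and qa = hadamard_nonzero_coords[OF q'(3) anz(2)]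
  obtain k where k: "k \<noteq> 0" "q * q' = k *s (p * p')"
    using eq pp' qq' p(1) q(1) p'(1) q'(1) by (auto simp: proj_point_eq_iff)
  define t where "t = (\<chi> i. q $ i / p $ i)"
  have t: "t $ i * p $ i = q $ i" "t $ i * q' $ i = k * p' $ i" for i
  proof -
    show "t $ i * p $ i = q $ i" using p(3) by (simp add: t_def)
    have "q $ i * q' $ i = k * (p $ i * p' $ i)" using k(2) by (simp add: vec_eq_iff)
    then show "t $ i * q' $ i = k * p' $ i" using p(3)[of i] by (simp add: t_def field_simps)
  qed
  have tnz: "t \<noteq> 0" using p(3) q(3) by (auto simp: t_def vec_eq_iff)
  have "(\<Sum>i\<in>UNIV. (p * a) $ i * 1 $ i) = 0" "(\<Sum>i\<in>UNIV. (q' * a') $ i * 1 $ i) = 0"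
    using P Q' p q' by (simp_all add: proj_line_def on_line_proj_point mult.commute)
  moreover have "(\<Sum>i\<in>UNIV. (p * a) $ i * t $ i) = 0"
  proof -
    have rw: "(p * a) $ i * t $ i = a $ i * q $ i" for i by (simp add: mult_ac flip: t(1))
    show ?thesis unfolding rw using Q q by (simp add: proj_line_def on_line_proj_point)
  qed
  moreover have "(\<Sum>i\<in>UNIV. (q' * a') $ i * t $ i) = 0"
  proof -
    have rw: "(q' * a') $ i * t $ i = k * (a' $ i * p' $ i)" for i
      using t(2)[of i] by (simp add: mult_ac)
    have "(\<Sum>i\<in>UNIV. a' $ i * p' $ i) = 0"
      using P' p' by (simp add: proj_line_def on_line_proj_point)
    then show ?thesis unfolding rw by (simp flip: sum_distrib_left)
  qed
  moreover have "proj_point (p * a) \<noteq> proj_point (q' * a')"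
    using ne pa(2) qa(2) p(1) q'(1) by auto
  moreover have one: "(1 :: 'k ^ 3) \<noteq> 0" by (simp add: vec_eq_iff)
  ultimately have "proj_point 1 = proj_point t"
    using points_or_lines_coincide[OF one tnz pa(1) qa(1)] by blast
  then have const: "t $ j = t $ i" for i j using tnz one by (simp add: proj_point_eq_iff_minors)
  have "p $ i * q $ j = p $ j * q $ i" for i j
    by (simp add: const[of j i] mult_ac flip: t(1))
  then have "P = Q" using p q by (simp add: proj_point_eq_iff_minors)
  with eq hadamard_cancel_left P show ?thesis by (metis DiffD2)
qed

theorem theorem3p12:
  fixes a a' :: "'k::alg_closed_field ^ 3"
    and L L' X X' :: "'k proj_plane set"
    and A A' :: "'k proj_plane"
    and n m :: nat
  assumes "a \<noteq> 0" and "a' \<noteq> 0"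
    and "L = proj_line a" and "L' = proj_line a'"
    and "A = proj_point a" and "A' = proj_point a'"
    and "X \<subseteq> L - Delta1" and "finite X" and "card X = n" and "n \<ge> 2"
    and "X' \<subseteq> L' - Delta1" and "finite X'" and "card X' = m" and "m \<ge> 2"
    and "A \<notin> Delta1" and "A' \<notin> Delta1"
    and "X \<inter> X' = {}"
  shows "(X \<star> X' = (X \<star> L') \<inter> (X' \<star> L) \<and> finite (X \<star> X') \<and> card (X \<star> X') = n * m) \<longleftrightarrow>
    (\<forall>P\<in>X. \<forall>P'\<in>X'. hadamard P A \<noteq> hadamard P' A')"
proof -
  have nz: "a $ i \<noteq> 0" "a' $ i \<noteq> 0" for i
    using assms by (auto simp: proj_point_in_Delta1)
  have off: "X \<inter> Delta1 = {}" "X' \<inter> Delta1 = {}" using assms by auto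
  have XL': "X \<star> L' = (\<Union>P\<in>X. line_translate P a')"
    and X'L: "X' \<star> L = (\<Union>P'\<in>X'. line_translate P' a)"
    using assms off by (simp_all add: hadamard_set_line)
  have fin: "finite (X \<star> X')" using assms hadamard_set_finite(2) by blast
  have XX': "X \<star> X' = {R. \<exists>P\<in>X. \<exists>P'\<in>X'. hadamard P P' = Some R}"
    using assms hadamard_set_finite(1) by blast
  show ?thesis
  proof
    assume grid: "X \<star> X' = (X \<star> L') \<inter> (X' \<star> L) \<and> finite (X \<star> X') \<and> card (X \<star> X') = n * m"
    show "\<forall>P\<in>X. \<forall>P'\<in>X'. hadamard P A \<noteq> hadamard P' A'"
    proof (intro ballI notI)
      fix P P' assume P: "P \<in> X" "P' \<in> X'" and eq: "hadamard P A = hadamard P' A'"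
      have "line_translate P a' = line_translate P' a"
        using line_translate_eq nz P off eq assms(5,6) by blast
      then have "line_translate P a' \<subseteq> X \<star> X'" using grid XL' X'L P by blast
      moreover have "infinite (line_translate P a')"
        using infinite_line_translate nz P off by blast
      ultimately show False using fin finite_subset by blast
    qed
  next
    assume ne: "\<forall>P\<in>X. \<forall>P'\<in>X'. hadamard P A \<noteq> hadamard P' A'"
    have "X \<star> X' = (X \<star> L') \<inter> (X' \<star> L)"
    proof (intro equalityI subsetI)
      fix R assume "R \<in> X \<star> X'"
      then obtain P P' where P: "P \<in> X" "P' \<in> X'" "hadamard P P' = Some R"
        unfolding XX' by blast
      then have "R \<in> line_translate P a'" "R \<in> line_translate P' a"
        using assms hadamard_commute[of P P'] unfolding line_translate_def by auto
      with P show "R \<in> (X \<star> L') \<inter> (X' \<star> L)" unfolding XL' X'L by blast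
    next
      fix R assume "R \<in> (X \<star> L') \<inter> (X' \<star> L)"
      then obtain P P' where P: "P \<in> X" "P' \<in> X'"
        "R \<in> line_translate P a'" "R \<in> line_translate P' a"
        unfolding XL' X'L by blast
      then have "hadamard P P' = Some R"
        using line_translates_meet[OF nz] ne assms by blast
      with P show "R \<in> X \<star> X'" unfolding XX' by blast
    qed
    moreover have "card (X \<star> X') = n * m"
    proof -
      let ?h = "\<lambda>(P, P'). hadamard P P'"
      have "inj_on ?h (X \<times> X')"
      proof (rule inj_onI, clarify)
        fix P P' Q Q' assume "P \<in> X" "P' \<in> X'" "Q \<in> X" "Q' \<in> X'" "hadamard P P' = hadamard Q Q'"
        then show "P = Q \<and> P' = Q'"
          using hadamard_inj_if_no_coincidence[OF nz, of P Q P' Q'] ne assms by blast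
      qed
      moreover have "Some ` (X \<star> X') = ?h ` (X \<times> X')"
      proof -
        have "\<exists>R. hadamard P P' = Some R" if "P \<in> X" for P P'
          using that off obtain_nonzero_coords[of P] proj_point_exhaust[of P']
            hadamard_nonzero_coords(2) by (metis disjoint_iff)
        then show ?thesis unfolding XX' by force
      qed
      ultimately have "card (Some ` (X \<star> X')) = card (X \<times> X')" by (simp add: card_image)
      then show ?thesis using assms by (simp add: card_image card_cartesian_product)
    qed
    ultimately show "X \<star> X' = (X \<star> L') \<inter> (X' \<star> L) \<and> finite (X \<star> X') \<and> card (X \<star> X') = n * m"
      using fin by blast
  qed
qed

end
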